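(* Let $q$ be a prime power, $M$ a subgroup of $\mathbb F_q^*$ with $m$ elements, and $n\ge1$. Then in the group ring $\mathbb Z[\mathrm{SL}_2(\mathbb F_q)]$, $$\left(\sum_{\mu\in M}\sum_{x\in\mathbb F_q}\left[\begin{pmatrix}x&\mu\\-1/\mu&0\end{pmatrix}\right]\right)^n=m^n\sum_{\begin{pmatrix}a&b\\c&d\end{pmatrix}\in\mathrm{SL}_2(\mathbb F_q)}\kappa_n(b,d)\left[\begin{pmatrix}a&b\\c&d\end{pmatrix}\right],$$ where $\kappa_n(b,d)$ is defined below.
   Context: Put $\epsilon(n)=1$ if $n$ is even and $0$ if $n$ is odd, and $k(n)=\lfloor (n-1)/2\rfloor$. Define $\beta_n=q^{\epsilon(n)}\frac{q^{2k(n)}-1}{q^2-1}$, $\alpha_n=\beta_n-\frac{q^{k(n)}-1}{q-1}$, $\gamma_n=\alpha_n+\frac{q^{k(n)}}{m}$. If $-1\in M$ put $\overline M=\mathbb F_q^*\setminus M$; if $-1\notin M$ put $\overline M=\mathbb F_q^*\setminus(M\cup -M)$. For a nonzero $(b,d)\in\mathbb F_q^2$ define $\kappa_n(b,d)$ as follows. Case $-1\in M$: if $d=0,b\in M$: $\beta_n$ ($n$ even), $\gamma_n$ ($n$ odd); if $d=0,b\in\overline M$: $\beta_n$ ($n$ even), $\alpha_n$ ($n$ odd); if $d\in M$: $\gamma_n$ ($n$ even), $\beta_n$ ($n$ odd); if $d\in\overline M$: $\alpha_n$ ($n$ even), $\beta_n$ ($n$ odd). Case $-1\notin M$ (values listed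 for $n\equiv0,1,2,3\pmod 4$): if $d=0,b\in M$: $\beta_n,\gamma_n,\beta_n,\alpha_n$; if $d=0,b\in -M$: $\beta_n,\alpha_n,\beta_n,\gamma_n$; if $d=0,b\in\overline M$: $\beta_n,\alpha_n,\beta_n,\alpha_n$; if $d\in M$: $\gamma_n,\beta_n,\alpha_n,\beta_n$; if $d\in -M$: $\alpha_n,\beta_n,\gamma_n,\beta_n$; if $d\in\overline M$: $\alpha_n,\beta_n,\alpha_n,\beta_n$. (Every element of $\mathrm{SL}_2$ has $(b,d)\neq(0,0)$.) *)

theory Defs
  imports "HOL-Analysis.Determinants" "HOL-Library.Poly_Mapping" "HOL-Algebra.Group"
begin

typedef (overloaded) 'a sl2 = "{A :: ('a::field)^2^2. det A = 1}"
  morphisms mat_of_sl2 sl2_of_mat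
  by (auto intro: exI[of _ "mat 1"])

(* The convolution product on finitely supported functions requires the
   index monoid to be written additively. Hence the group operation
   of SL_2, matrix multiplication, is written + below, and the type
   'a sl2 \<Rightarrow>\<^sub>0 int is the group ring Z[SL_2], with [A] = single A 1. *)

instantiation sl2 :: (field) group_add
begin

definition zero_sl2 :: "'a sl2" where
  "0 = sl2_of_mat (mat 1)"

definition plus_sl2 :: "'a sl2 \<Rightarrow> 'a sl2 \<Rightarrow> 'a sl2" where
  "A + B = sl2_of_mat (mat_of_sl2 A ** mat_of_sl2 B)"

definition uminus_sl2 :: "'a sl2 \<Rightarrow> 'a sl2" where
  "- A = sl2_of_mat (matrix_inv (mat_of_sl2 A))"

definition minus_sl2 :: "'a sl2 \<Rightarrow> 'a sl2 \<Rightarrow> 'a sl2" where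
  "A - B = A + (- B)" for A B :: "'a sl2"

lemma det_mat_of_sl2: "det (mat_of_sl2 A) = 1"
  using mat_of_sl2[of A] by simp

lemma mat_of_sl2_zero: "mat_of_sl2 0 = mat 1"
  by (simp add: zero_sl2_def sl2_of_mat_inverse)

lemma mat_of_sl2_plus: "mat_of_sl2 (A + B) = mat_of_sl2 A ** mat_of_sl2 B"
  by (simp add: plus_sl2_def sl2_of_mat_inverse det_mul det_mat_of_sl2)

lemma mat_of_sl2_uminus: "mat_of_sl2 (- A) = matrix_inv (mat_of_sl2 A)"
  and matrix_inv_mat_of_sl2: "matrix_inv (mat_of_sl2 A) ** mat_of_sl2 A = mat 1"
proof -
  have inv: "invertible (mat_of_sl2 A)"
    by (simp add: invertible_det_nz det_mat_of_sl2)
  then show 1: "matrix_inv (mat_of_sl2 A) ** mat_of_sl2 A = mat 1"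
    unfolding invertible_def matrix_inv_def by (rule someI2_ex) simp
  have "det (matrix_inv (mat_of_sl2 A) ** mat_of_sl2 A) = 1"
    by (simp add: 1)
  then have "det (matrix_inv (mat_of_sl2 A)) = 1"
    by (simp add: det_mul det_mat_of_sl2)
  then show "mat_of_sl2 (- A) = matrix_inv (mat_of_sl2 A)"
    by (simp add: uminus_sl2_def sl2_of_mat_inverse)
qed

instance
proof
  fix A B C :: "'a sl2"
  show "A + B + C = A + (B + C)"
    by (simp add: mat_of_sl2_inject[symmetric] mat_of_sl2_plus matrix_mul_assoc)
  show "0 + A = A" "A + 0 = A"
    by (simp_all add: mat_of_sl2_inject[symmetric] mat_of_sl2_plus mat_of_sl2_zero)
  show "- A + A = 0"
    by (simp add: mat_of_sl2_inject[symmetric] mat_of_sl2_plus mat_of_sl2_zero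
        mat_of_sl2_uminus matrix_inv_mat_of_sl2)
  show "A + - B = A - B"
    by (simp add: minus_sl2_def)
qed

end

instance sl2 :: ("{field,finite}") finite
proof
  have "inj (mat_of_sl2 :: 'a sl2 \<Rightarrow> _)"
    by (simp add: inj_def mat_of_sl2_inject)
  then show "finite (UNIV :: 'a sl2 set)"
    by (rule finite_imageD[rotated]) (rule finite)
qed

abbreviation upper_right :: "'a::field sl2 \<Rightarrow> 'a" where
  "upper_right A \<equiv> mat_of_sl2 A $ 1 $ 2"

abbreviation lower_right :: "'a::field sl2 \<Rightarrow> 'a" where
  "lower_right A \<equiv> mat_of_sl2 A $ 2 $ 2"

definition gen :: "'a::field \<Rightarrow> 'a \<Rightarrow> 'a sl2" where
  "gen x \<mu> = sl2_of_mat (vector [vector [x, \<mu>], vector [- 1 / \<mu>, 0]])"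

lemma mat_of_sl2_gen:
  assumes "\<mu> \<noteq> 0"
  shows "mat_of_sl2 (gen x \<mu>) = vector [vector [x, \<mu>], vector [- 1 / \<mu>, 0]]"
  using assms by (simp add: gen_def sl2_of_mat_inverse det_2)

definition field_units :: "'a::field monoid" where
  "field_units = \<lparr>carrier = UNIV - {0}, monoid.mult = (*), one = 1\<rparr>"

definition eps :: "nat \<Rightarrow> nat" where
  "eps n = (if even n then 1 else 0)"

definition kk :: "nat \<Rightarrow> nat" where
  "kk n = (n - 1) div 2"

definition beta :: "nat \<Rightarrow> nat \<Rightarrow> rat" where
  "beta q n = of_nat q ^ eps n * ((of_nat q ^ (2 * kk n) - 1) / (of_nat q ^ 2 - 1))"

definition alpha :: "nat \<Rightarrow> nat \<Rightarrow> rat" where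
  "alpha q n = beta q n - (of_nat q ^ kk n - 1) / (of_nat q - 1)"

definition gamma :: "nat \<Rightarrow> nat \<Rightarrow> nat \<Rightarrow> rat" where
  "gamma q m n = alpha q n + of_nat q ^ kk n / of_nat m"

definition neg_set :: "'a::field set \<Rightarrow> 'a set" where
  "neg_set M = uminus ` M"

definition Mbar :: "'a::field set \<Rightarrow> 'a set" where
  "Mbar M = (if - 1 \<in> M then (UNIV - {0}) - M else (UNIV - {0}) - (M \<union> neg_set M))"

(* The prime power q is CARD('a), and m is card M.
   Only meaningful for (b, d) \<noteq> (0, 0), where one of the listed cases applies;
   the value 0 at (0, 0) is a dummy. *)
definition kappa :: "'a::{field,finite} set \<Rightarrow> nat \<Rightarrow> 'a \<Rightarrow> 'a \<Rightarrow> rat" where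
  "kappa M n b d =
    (let \<beta> = beta CARD('a) n; \<alpha> = alpha CARD('a) n; \<gamma> = gamma CARD('a) (card M) n in
     if - 1 \<in> M then
       (if d = 0 \<and> b \<in> M then (if even n then \<beta> else \<gamma>)
        else if d = 0 \<and> b \<in> Mbar M then (if even n then \<beta> else \<alpha>)
        else if d \<in> M then (if even n then \<gamma> else \<beta>)
        else if d \<in> Mbar M then (if even n then \<alpha> else \<beta>)
        else 0)
     else
       (if d = 0 \<and> b \<in> M then [\<beta>, \<gamma>, \<beta>, \<alpha>] ! (n mod 4)
        else if d = 0 \<and> b \<in> neg_set M then [\<beta>, \<alpha>, \<beta>, \<gamma>] ! (n mod 4)
        else if d = 0 \<and> b \<in> Mbar M then [\<beta>, \<alpha>, \<beta>, \<alpha>] ! (n mod 4)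
        else if d \<in> M then [\<gamma>, \<beta>, \<alpha>, \<beta>] ! (n mod 4)
        else if d \<in> neg_set M then [\<alpha>, \<beta>, \<gamma>, \<beta>] ! (n mod 4)
        else if d \<in> Mbar M then [\<alpha>, \<beta>, \<alpha>, \<beta>] ! (n mod 4)
        else 0))"

(* The inclusion of Z[G] into Q[G]: the values of kappa are rational, in general
   not integral (gamma has denominator m). *)
definition to_rat_group_ring :: "('g \<Rightarrow>\<^sub>0 int) \<Rightarrow> ('g \<Rightarrow>\<^sub>0 rat)" where
  "to_rat_group_ring f = Poly_Mapping.map rat_of_int f"

lemma lookup_to_rat_group_ring:
  "Poly_Mapping.lookup (to_rat_group_ring f) g = rat_of_int (Poly_Mapping.lookup f g)"
  by (simp add: to_rat_group_ring_def Poly_Mapping.map.rep_eq when_def)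

end

theory Submission
  imports Defs
begin

text \<open>
  The coefficient of a power of the generating element at a matrix depends only on its second
  column \<open>(b, d)\<close>, and left multiplication by the inverse of \<open>gen x \<mu>\<close> sends this column
  to \<open>(- \<mu> d, b / \<mu> + x d)\<close>. This gives a recursion for the coefficients in which, for
  \<open>d \<noteq> 0\<close>, the second entry runs through the whole field with \<open>x\<close>. The case distinction in
  the definition of \<open>kappa\<close> collapses to the parity of \<open>n\<close> once membership in \<open>M\<close> is
  tested up to the sign \<open>(-1) ^ (n div 2)\<close>, and then \<open>kappa\<close> satisfies the same recursion.
\<close>

section \<open>Group ring coefficients and second columns\<close>

text \<open>In a group \<open>k = l + b\<close> has the single solution \<open>b = - l + k\<close>,
  so convolution with a point mass is a translation. The sum is noncommutative, hence the inverse
  stays on the left.\<close>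

lemma lookup_single_times:
  fixes g :: "'g::group_add \<Rightarrow>\<^sub>0 'r::semiring_0"
  shows "Poly_Mapping.lookup (Poly_Mapping.single a c * g) k = c * Poly_Mapping.lookup g (- a + k)"
proof -
  have inner: "(\<Sum>b. Poly_Mapping.lookup g b when k = l + b) = Poly_Mapping.lookup g (- l + k)" for l
  proof -
    have "k = l + b \<longleftrightarrow> b = - l + k" for b
      by (metis add.assoc add.left_neutral add.right_inverse left_minus)
    then show ?thesis by simp
  qed
  have "Poly_Mapping.lookup (Poly_Mapping.single a c * g) k =
      (\<Sum>l. (c when a = l) * Poly_Mapping.lookup g (- l + k))"
    by (simp add: lookup_mult lookup_single inner)
  also have "\<dots> = (\<Sum>l. c * Poly_Mapping.lookup g (- a + k) when a = l)"
    by (rule Sum_any.cong) (simp add: when_def)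
  also have "\<dots> = c * Poly_Mapping.lookup g (- a + k)"
    by simp
  finally show ?thesis .
qed

lemma lookup_of_nat_times:
  fixes g :: "'g::group_add \<Rightarrow>\<^sub>0 'r::semiring_1"
  shows "Poly_Mapping.lookup (of_nat j * g) k = of_nat j * Poly_Mapping.lookup g k"
  by (induction j) (simp_all add: distrib_right lookup_add)

text \<open>The inverse matrix is never computed: writing \<open>A = gen x \<mu> + B\<close>
  expresses the second column of \<open>A\<close> through that of \<open>B\<close>, and these two
  linear equations are solved for \<open>B\<close>.\<close>

lemma second_column_uminus_gen_plus:
  fixes A :: "'a::field sl2"
  assumes "\<mu> \<noteq> 0"
  shows "upper_right (- gen x \<mu> + A) = - \<mu> * lower_right A"
    and "lower_right (- gen x \<mu> + A) = upper_right A / \<mu> + x * lower_right A"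
proof -
  define B where "B = - gen x \<mu> + A"
  have "A = gen x \<mu> + B"
    by (simp add: B_def add.assoc[symmetric])
  then have A: "mat_of_sl2 A = vector [vector [x, \<mu>], vector [- 1 / \<mu>, 0]] ** mat_of_sl2 B"
    using assms by (simp add: mat_of_sl2_plus mat_of_sl2_gen)
  have b: "upper_right A = x * upper_right B + \<mu> * lower_right B"
    and d: "lower_right A = - 1 / \<mu> * upper_right B"
    by (simp_all add: A matrix_matrix_mult_def sum_2)
  show 1: "upper_right (- gen x \<mu> + A) = - \<mu> * lower_right A"
    using assms by (simp add: d flip: B_def)
  show "lower_right (- gen x \<mu> + A) = upper_right A / \<mu> + x * lower_right A"
    using assms by (simp add: b d field_simps flip: B_def)
qed

lemma sl2_second_column_nonzero:
  fixes A :: "'a::field sl2"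
  shows "upper_right A \<noteq> 0 \<or> lower_right A \<noteq> 0"
  using det_mat_of_sl2[of A] by (auto simp: det_2)

text \<open>Three entries suffice, because determinant 1 forces the lower left entry once the lower
  right one vanishes.\<close>

lemma eq_gen_iff:
  fixes A :: "'a::field sl2"
  assumes "\<mu> \<noteq> 0"
  shows "gen x \<mu> = A \<longleftrightarrow> lower_right A = 0 \<and> upper_right A = \<mu> \<and> mat_of_sl2 A $ 1 $ 1 = x"
proof -
  have "mat_of_sl2 A $ 2 $ 1 = - 1 / \<mu>" if "lower_right A = 0" "upper_right A = \<mu>"
  proof -
    have "- (\<mu> * mat_of_sl2 A $ 2 $ 1) = 1"
      using det_mat_of_sl2[of A] that by (simp add: det_2)
    then have "\<mu> * mat_of_sl2 A $ 2 $ 1 = - 1"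
      by (metis minus_minus)
    then show ?thesis
      using assms by (metis nonzero_mult_div_cancel_left)
  qed
  then show ?thesis
    using assms by (auto simp: mat_of_sl2_inject[symmetric] mat_of_sl2_gen vec_eq_iff forall_2)
qed

text \<open>Agrees with \<open>kappa\<close> away from \<open>(0, 0)\<close>; multiplying by the sign tests
  membership in \<open>M\<close> or \<open>- M\<close>, according to \<open>n mod 4\<close>.\<close>

definition signed_kappa :: "'a::{field,finite} set \<Rightarrow> nat \<Rightarrow> 'a \<Rightarrow> 'a \<Rightarrow> rat" where
  "signed_kappa M n b d =
    (let v = (\<lambda>t. if (- 1) ^ (n div 2) * t \<in> M
                   then gamma CARD('a) (card M) n else alpha CARD('a) n) in
     if odd n then (if d = 0 then v b else beta CARD('a) n)
     else (if d = 0 then beta CARD('a) n else v d))"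

section \<open>Recursions for the three coefficient sequences\<close>

text \<open>From 2k+1 to 2k+2 only \<open>eps\<close> changes, while \<open>kk\<close> stays k. From
  2k+2 to 2k+3 the geometric sum in powers of q^2 gains a term and the extra factor q is
  dropped.\<close>

lemma beta_Suc:
  "beta q (2 * k + 2) = of_nat q * beta q (2 * k + 1)"
  "q \<ge> 2 \<Longrightarrow> beta q (2 * k + 3) = of_nat q * beta q (2 * k + 2) + 1"
proof -
  show "beta q (2 * k + 2) = of_nat q * beta q (2 * k + 1)"
    by (simp add: beta_def eps_def kk_def)
  assume "q \<ge> 2"
  then have "(of_nat q :: rat) ^ 2 - 1 \<noteq> 0"
    by (metis less_irrefl of_nat_1 of_nat_less_iff of_nat_power one_less_power
        pos2 right_minus_eq less_le_trans one_less_numeral_iff semiring_norm(76))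
  then show "beta q (2 * k + 3) = of_nat q * beta q (2 * k + 2) + 1"
    by (simp add: beta_def eps_def kk_def field_simps power2_eq_square)
qed

text \<open>These mirror the two kinds of step of the sum over x: for d nonzero and odd index, one x
  makes the lower entry vanish and the other q - 1 contribute \<beta>; for d = 0 and even index, all
  q summands agree.\<close>

lemma alpha_Suc:
  assumes "q \<ge> 2"
  shows "alpha q (2 * k + 2) = (of_nat q - 1) * beta q (2 * k + 1) + alpha q (2 * k + 1)"
    and "alpha q (2 * k + 3) = of_nat q * alpha q (2 * k + 2)"
proof -
  have "(of_nat q :: rat) \<noteq> 1" using assms by simp
  show "alpha q (2 * k + 2) = (of_nat q - 1) * beta q (2 * k + 1) + alpha q (2 * k + 1)"
    unfolding alpha_def beta_Suc by (simp add: kk_def algebra_simps)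
  show "alpha q (2 * k + 3) = of_nat q * alpha q (2 * k + 2)"
    unfolding alpha_def beta_Suc(2)[OF assms] using \<open>of_nat q \<noteq> 1\<close>
    by (simp add: kk_def field_simps)
qed

lemma gamma_Suc:
  assumes "q \<ge> 2"
  shows "gamma q m (2 * k + 2) = (of_nat q - 1) * beta q (2 * k + 1) + gamma q m (2 * k + 1)"
    and "gamma q m (2 * k + 3) = of_nat q * gamma q m (2 * k + 2)"
  unfolding gamma_def alpha_Suc[OF assms] by (simp_all add: kk_def algebra_simps)

text \<open>This evaluates a sum over the field in which 0 has weight \<beta>, m elements have
  weight \<gamma> and the others \<alpha>. Since \<gamma> exceeds \<alpha> by q^k/m, the m copies
  add q^k, which meets -(q^k - 1) and leaves 1.\<close>

lemma beta_eq_weighted_sum: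
  assumes "q \<ge> 2" "m \<noteq> 0"
  shows "beta q (2 * k + 3) = beta q (2 * k + 2) + of_nat m * gamma q m (2 * k + 2)
           + (of_nat q - 1 - of_nat m) * alpha q (2 * k + 2)"
proof -
  let ?B = "beta q (2 * k + 2)" and ?c = "((of_nat q :: rat) ^ k - 1) / (of_nat q - 1)"
  have c: "(of_nat q - 1) * ?c = of_nat q ^ k - 1" using assms by simp
  have "?B + of_nat m * gamma q m (2 * k + 2) + (of_nat q - 1 - of_nat m) * alpha q (2 * k + 2)
      = ?B + (of_nat q - 1) * (?B - ?c) + of_nat q ^ k"
    using assms(2) by (simp add: gamma_def alpha_def kk_def distrib_left left_diff_distrib)
  also have "\<dots> = of_nat q * ?B + 1"
    unfolding right_diff_distrib c by (simp add: left_diff_distrib)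
  finally show ?thesis
    by (simp only: beta_Suc(2)[OF assms(1)])
qed

lemma CARD_field_ge_2: "CARD('a::{field,finite}) \<ge> 2"
proof -
  have "card {0, 1 :: 'a} \<le> CARD('a)"
    by (rule card_mono) auto
  then show ?thesis by simp
qed

lemma sum_affine:
  fixes g :: "'a::{field,finite} \<Rightarrow> 'b::comm_monoid_add"
  assumes "d \<noteq> 0"
  shows "(\<Sum>x\<in>UNIV. g (c + x * d)) = (\<Sum>y\<in>UNIV. g y)"
  by (rule sum.reindex_bij_witness[of _ "\<lambda>y. (y - c) / d" "\<lambda>x. c + x * d"])
    (use assms in auto)

lemma sum_if_eq_zero:
  "(\<Sum>y\<in>(UNIV :: 'a::{field,finite} set). if y = 0 then u else v) = u + (of_nat CARD('a) - 1) * (v :: rat)"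
proof -
  have "(\<Sum>y\<in>(UNIV :: 'a set). if y = 0 then u else v)
      = u + (\<Sum>y\<in>UNIV - {0 :: 'a}. if y = 0 then u else v)"
    by (subst sum.remove[of _ 0]) auto
  also have "(\<Sum>y\<in>UNIV - {0 :: 'a}. if y = 0 then u else v) = (\<Sum>y\<in>UNIV - {0 :: 'a}. v)"
    by (rule sum.cong) auto
  also have "\<dots> = (of_nat CARD('a) - 1) * v"
    using CARD_field_ge_2[where 'a = 'a] by (simp add: card_Diff_singleton of_nat_diff)
  finally show ?thesis .
qed

section \<open>Membership in the subgroup and the case distinction\<close>

locale unit_subgroup =
  fixes M :: "'a::{field,finite} set"
  assumes sub: "subgroup M field_units"
begin

lemma nonzero: "\<mu> \<in> M \<Longrightarrow> \<mu> \<noteq> 0"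
  using subgroup.subset[OF sub] by (auto simp: field_units_def)

lemma one_mem: "1 \<in> M"
  using subgroup.one_closed[OF sub] by (simp add: field_units_def)

lemma mult_mem: "\<mu> \<in> M \<Longrightarrow> \<nu> \<in> M \<Longrightarrow> \<mu> * \<nu> \<in> M"
  using subgroup.m_closed[OF sub] by (simp add: field_units_def)

text \<open>Closure concerns the inverse of \<open>field_units\<close>, which uniqueness of inverses
  in a group identifies with the field inverse.\<close>

lemma inverse_mem:
  assumes "\<mu> \<in> M"
  shows "inverse \<mu> \<in> M"
proof -
  have "group (field_units :: 'a monoid)"
    by (rule groupI) (auto simp: field_units_def intro!: bexI[of _ "inverse x" for x])
  then have "inv\<^bsub>field_units\<^esub> \<mu> = inverse \<mu>"
    using nonzero[OF assms] by (intro group.inv_equality) (auto simp: field_units_def)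
  then show ?thesis
    using subgroup.m_inv_closed[OF sub assms] by simp
qed

lemma mult_mem_iff: "\<mu> \<in> M \<Longrightarrow> \<mu> * t \<in> M \<longleftrightarrow> t \<in> M"
  using mult_mem[of \<mu> t] mult_mem[of "inverse \<mu>" "\<mu> * t"] inverse_mem[of \<mu>] nonzero[of \<mu>]
  by (auto simp: mult.assoc[symmetric])

lemma mult_mem_iff': "\<mu> \<in> M \<Longrightarrow> t * \<mu> \<in> M \<longleftrightarrow> t \<in> M"
  using mult_mem_iff[of \<mu> t] by (simp add: mult.commute)

lemma divide_mem_iff: "\<mu> \<in> M \<Longrightarrow> t / \<mu> \<in> M \<longleftrightarrow> t \<in> M"
  using mult_mem_iff'[OF inverse_mem[of \<mu>], of t] by (simp add: divide_inverse)

lemma card_nonzero: "card M \<noteq> 0"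
  using one_mem by auto

text \<open>If -1 lies in \<open>M\<close>, the sign does not affect membership. Otherwise
  \<open>M\<close> and its negative are disjoint, and \<open>n mod 4\<close> fixes the parities of
  both \<open>n\<close> and \<open>n div 2\<close>, hence the sign.\<close>

lemma kappa_eq_signed_kappa:
  assumes "b \<noteq> 0 \<or> d \<noteq> 0"
  shows "kappa M n b d = signed_kappa M n b d"
proof (cases "- 1 \<in> M")
  case True
  then have "(- 1) ^ j * t \<in> M \<longleftrightarrow> t \<in> M" for j t
    using mult_mem_iff[OF True, of t] by (cases "even j") auto
  then show ?thesis
    using True assms nonzero by (auto simp: kappa_def signed_kappa_def Mbar_def Let_def)
next
  case False
  have neg: "t \<in> neg_set M \<longleftrightarrow> - t \<in> M" for t
    by (auto simp: neg_set_def image_iff intro: bexI[of _ "- t"])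
  have disj: "\<not> (t \<in> M \<and> - t \<in> M)" for t
    using False mult_mem_iff[of t "- 1"] by auto
  consider "n mod 4 = 0" | "n mod 4 = 1" | "n mod 4 = 2" | "n mod 4 = 3"
    by linarith
  then show ?thesis
  proof cases
    case 1
    then have "even n" "even (n div 2)" by presburger+
    then show ?thesis
      using \<open>n mod 4 = 0\<close> False assms nonzero disj
      by (auto simp: kappa_def signed_kappa_def Mbar_def Let_def neg)
  next
    case 2
    then have "odd n" "even (n div 2)" by presburger+
    then show ?thesis
      using \<open>n mod 4 = 1\<close> False assms nonzero disj
      by (auto simp: kappa_def signed_kappa_def Mbar_def Let_def neg)
  next
    case 3
    then have "even n" "odd (n div 2)" by presburger+
    then show ?thesis
      using \<open>n mod 4 = 2\<close> False assms nonzero disj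
      by (auto simp: kappa_def signed_kappa_def Mbar_def Let_def neg)
  next
    case 4
    then have "odd n" "odd (n div 2)" by presburger+
    then show ?thesis
      using \<open>n mod 4 = 3\<close> False assms nonzero disj
      by (auto simp: kappa_def signed_kappa_def Mbar_def Let_def neg numeral_3_eq_3)
  qed
qed

section \<open>The recursion for the signed form\<close>

lemma sum_if_coset:
  assumes "e \<noteq> 0"
  shows "(\<Sum>y\<in>UNIV. if y = 0 then u else if e * y \<in> M then w else (v :: rat)) =
           u + of_nat (card M) * w + (of_nat CARD('a) - 1 - of_nat (card M)) * v"
proof -
  have "(\<Sum>y\<in>UNIV. if y = 0 then u else if e * y \<in> M then w else v)
      = (\<Sum>y\<in>UNIV. if y = 0 then u else if y \<in> M then w else v)"
    by (rule sum.reindex_bij_witness[of _ "\<lambda>y. y / e" "\<lambda>y. e * y"]) (use assms in auto)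
  \<comment> \<open>As 0 is not in \<open>M\<close>, the nested conditional splits into two
    independent summands.\<close>
  also have "\<dots> = (\<Sum>y\<in>UNIV. (if y = 0 then u else v) + (if y \<in> M then w - v else 0))"
    by (rule sum.cong) (use nonzero in auto)
  also have "\<dots> = u + (of_nat CARD('a) - 1) * v + of_nat (card M) * (w - v)"
    by (simp add: sum.distrib sum_if_eq_zero sum.If_cases)
  finally show ?thesis by (simp add: algebra_simps)
qed

text \<open>Already for each fixed \<mu> the sum over x gives the next value, so the sum over \<mu>
  only contributes the factor \<open>card M\<close>.\<close>

lemma signed_kappa_step:
  assumes "b \<noteq> 0 \<or> d \<noteq> 0" "n \<ge> 1"
  shows "(\<Sum>\<mu>\<in>M. \<Sum>x\<in>UNIV. signed_kappa M n (- \<mu> * d) (b / \<mu> + x * d)) =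
           of_nat (card M) * signed_kappa M (Suc n) b d"
proof -
  have card: "CARD('a) \<ge> 2" by (rule CARD_field_ge_2)
  have "(\<Sum>x\<in>UNIV. signed_kappa M n (- \<mu> * d) (b / \<mu> + x * d)) = signed_kappa M (Suc n) b d"
    if \<mu>: "\<mu> \<in> M" for \<mu>
  proof (cases "odd n")
    case True
    then obtain k where n: "n = 2 * k + 1" by (auto elim: oddE)
    have Suc: "Suc n = 2 * k + 2" using n by simp
    show ?thesis
    proof (cases "d = 0")
      case True
      \<comment> \<open>Here every x gives the column (0, b / \<mu>) with nonzero lower entry, so
        the sum is q times \<beta>.\<close>
      then show ?thesis
        using assms nonzero[OF \<mu>] beta_Suc(1)[of "CARD('a)" k]
        unfolding Suc by (simp add: signed_kappa_def n)
    next
      case False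
      let ?v = "if (- 1) ^ k * (- \<mu> * d) \<in> M
                then gamma CARD('a) (card M) n else alpha CARD('a) n"
      \<comment> \<open>The minus sign in the new upper entry supplies the sign change as
        \<open>n div 2\<close> grows from k to k + 1.\<close>
      have mem: "(- 1) ^ k * (- \<mu> * d) \<in> M \<longleftrightarrow> (- 1) ^ Suc k * d \<in> M"
        using mult_mem_iff[OF \<mu>, of "(- 1) ^ Suc k * d"] by (simp add: mult_ac)
      have "(\<Sum>x\<in>UNIV. signed_kappa M n (- \<mu> * d) (b / \<mu> + x * d)) =
          (\<Sum>y\<in>UNIV. signed_kappa M n (- \<mu> * d) y)"
        by (rule sum_affine[OF False])
      also have "\<dots> = (\<Sum>y\<in>(UNIV :: 'a set). if y = 0 then ?v else beta CARD('a) n)"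
        by (rule sum.cong) (simp_all add: signed_kappa_def n)
      also have "\<dots> = ?v + (of_nat CARD('a) - 1) * beta CARD('a) n"
        by (rule sum_if_eq_zero)
      also have "\<dots> = signed_kappa M (2 * k + 2) b d"
        using False mem alpha_Suc(1)[OF card, of k] gamma_Suc(1)[OF card, of "card M" k]
        by (simp add: signed_kappa_def n)
      finally show ?thesis unfolding Suc .
    qed
  next
    case False
    then obtain k where n: "n = 2 * k + 2"
      using assms(2) by (metis add_2_eq_Suc' evenE mult_Suc_right not_one_le_zero
          mult_0_right not0_implies_Suc add.commute)
    have Suc: "Suc n = 2 * k + 3" using n by simp
    \<comment> \<open>Both indices have the same half, so the sign is unchanged in this
      step.\<close>
    have half: "(2 * k + 2) div 2 = Suc k" "(2 * k + 3) div 2 = Suc k" by auto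
    show ?thesis
    proof (cases "d = 0")
      case True
      have mem: "(- 1) ^ Suc k * (b / \<mu>) \<in> M \<longleftrightarrow> (- 1) ^ Suc k * b \<in> M"
        using divide_mem_iff[OF \<mu>, of "(- 1) ^ Suc k * b"] by simp
      have "signed_kappa M n 0 (b / \<mu>) = (if (- 1) ^ Suc k * b \<in> M
          then gamma CARD('a) (card M) n else alpha CARD('a) n)"
        using True assms(1) nonzero[OF \<mu>] mem by (simp add: signed_kappa_def n half)
      moreover have "signed_kappa M (2 * k + 3) b 0 = (if (- 1) ^ Suc k * b \<in> M
          then gamma CARD('a) (card M) (2 * k + 3) else alpha CARD('a) (2 * k + 3))"
        by (simp add: signed_kappa_def half)
      ultimately show ?thesis
        unfolding Suc gamma_Suc(2)[OF card] alpha_Suc(2)[OF card] by (simp add: True n)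
    next
      case False
      have "(\<Sum>x\<in>UNIV. signed_kappa M n (- \<mu> * d) (b / \<mu> + x * d)) =
          (\<Sum>y\<in>UNIV. signed_kappa M n (- \<mu> * d) y)"
        by (rule sum_affine[OF False])
      also have "\<dots> = (\<Sum>y\<in>UNIV. if y = 0 then beta CARD('a) n
          else if (- 1) ^ Suc k * y \<in> M
               then gamma CARD('a) (card M) n else alpha CARD('a) n)"
        by (rule sum.cong) (simp_all add: signed_kappa_def n half)
      also have "\<dots> = beta CARD('a) (2 * k + 3)"
        by (subst sum_if_coset) (simp_all add: beta_eq_weighted_sum[OF card card_nonzero] n)
      also have "\<dots> = signed_kappa M (2 * k + 3) b d"
        using False by (simp add: signed_kappa_def)
      finally show ?thesis unfolding Suc .
    qed
  qed
  then show ?thesis by simp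
qed

text \<open>For n = 1 the exponent \<open>kk\<close> is 0, so \<alpha> and \<beta> vanish and
  \<gamma> = 1/m.\<close>

lemma signed_kappa_1:
  "of_nat (card M) * signed_kappa M 1 b d = (if d = 0 \<and> b \<in> M then 1 else 0)"
  using card_nonzero
  by (simp add: signed_kappa_def gamma_def alpha_def beta_def eps_def kk_def)

section \<open>Coefficients of the powers\<close>

abbreviation gen_sum :: "'a sl2 \<Rightarrow>\<^sub>0 int" where
  "gen_sum \<equiv> \<Sum>\<mu>\<in>M. \<Sum>x\<in>UNIV. Poly_Mapping.single (gen x \<mu>) 1"

lemma lookup_gen_sum:
  "Poly_Mapping.lookup gen_sum A = (if lower_right A = 0 \<and> upper_right A \<in> M then 1 else 0)"
proof -
  have "Poly_Mapping.lookup gen_sum A =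
      (\<Sum>\<mu>\<in>M. \<Sum>x\<in>UNIV. if gen x \<mu> = A then 1 else 0)"
    by (simp add: lookup_sum lookup_single when_def eq_commute[of A])
  also have "\<dots> = (\<Sum>\<mu>\<in>M. \<Sum>x\<in>UNIV.
      if x = mat_of_sl2 A $ 1 $ 1 then if lower_right A = 0 \<and> upper_right A = \<mu> then 1 else 0 else 0)"
    by (intro sum.cong refl) (auto simp: eq_gen_iff nonzero)
  also have "\<dots> = (\<Sum>\<mu>\<in>M. if \<mu> = upper_right A then if lower_right A = 0 then 1 else 0 else 0)"
    by (intro sum.cong refl) auto
  finally show ?thesis by simp
qed

lemma lookup_gen_sum_times:
  "Poly_Mapping.lookup (gen_sum * f) A =
    (\<Sum>\<mu>\<in>M. \<Sum>x\<in>UNIV. Poly_Mapping.lookup f (- gen x \<mu> + A))"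
  by (simp add: sum_distrib_right lookup_sum lookup_single_times)

text \<open>Induction splits off a left factor, which translates the argument by
  \<open>- gen x \<mu>\<close>; the coefficient depends on the second column alone, so
  \<open>signed_kappa_step\<close> applies.\<close>

lemma lookup_gen_sum_power:
  assumes "n \<ge> 1"
  shows "of_int (Poly_Mapping.lookup (gen_sum ^ n) A) =
           of_nat (card M) ^ n * signed_kappa M n (upper_right A) (lower_right A)"
  using assms
proof (induction n arbitrary: A rule: dec_induct)
  case base
  show ?case
    by (simp only: power_one_right lookup_gen_sum signed_kappa_1) simp
next
  case (step n)
  let ?b = "upper_right A" and ?d = "lower_right A"
  have "rat_of_int (Poly_Mapping.lookup (gen_sum ^ Suc n) A) =
      (\<Sum>\<mu>\<in>M. \<Sum>x\<in>UNIV. of_int (Poly_Mapping.lookup (gen_sum ^ n) (- gen x \<mu> + A)))"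
    by (simp add: lookup_gen_sum_times)
  also have "\<dots> = (\<Sum>\<mu>\<in>M. \<Sum>x\<in>UNIV.
      of_nat (card M) ^ n * signed_kappa M n (- \<mu> * ?d) (?b / \<mu> + x * ?d))"
    by (intro sum.cong refl)
      (simp only: step.IH second_column_uminus_gen_plus[OF nonzero])
  also have "\<dots> = of_nat (card M) ^ n *
      (\<Sum>\<mu>\<in>M. \<Sum>x\<in>UNIV. signed_kappa M n (- \<mu> * ?d) (?b / \<mu> + x * ?d))"
    by (simp only: sum_distrib_left)
  also have "\<dots> = of_nat (card M) ^ Suc n * signed_kappa M (Suc n) ?b ?d"
    by (subst signed_kappa_step[OF sl2_second_column_nonzero step.hyps(1)]) simp
  finally show ?case .
qed

end

theorem theorem6:
  fixes M :: "'a::{field,finite} set" and n :: nat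
  assumes "subgroup M field_units"
    and "n \<ge> 1"
  shows "to_rat_group_ring
           ((\<Sum>\<mu>\<in>M. \<Sum>x\<in>UNIV. Poly_Mapping.single (gen x \<mu>) (1::int)) ^ n) =
         of_nat (card M) ^ n *
           (\<Sum>A\<in>UNIV. Poly_Mapping.single A (kappa M n (upper_right A) (lower_right A)))"
proof -
  interpret unit_subgroup M
    by (rule unit_subgroup.intro) (rule assms(1))
  show ?thesis
  proof (rule poly_mapping_eqI)
    fix A :: "'a sl2"
    \<comment> \<open>The power is folded into one natural number, so that the group ring scalar
      acts coefficientwise.\<close>
    have "Poly_Mapping.lookup (of_nat (card M) ^ n *
        (\<Sum>A\<in>UNIV. Poly_Mapping.single A (kappa M n (upper_right A) (lower_right A)))) A =
        of_nat (card M) ^ n * kappa M n (upper_right A) (lower_right A)"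
      by (simp add: lookup_of_nat_times lookup_sum lookup_single when_def
          del: of_nat_power flip: of_nat_power)
    then show "Poly_Mapping.lookup (to_rat_group_ring (gen_sum ^ n)) A =
        Poly_Mapping.lookup (of_nat (card M) ^ n *
          (\<Sum>A\<in>UNIV. Poly_Mapping.single A (kappa M n (upper_right A) (lower_right A)))) A"
      by (simp only: lookup_to_rat_group_ring lookup_gen_sum_power[OF assms(2)]
          kappa_eq_signed_kappa[OF sl2_second_column_nonzero])
  qed
qed

end
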